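(* Let $N\ge 1$, $d$ a positive divisor of $N$, $\epsilon\in(\mathbb Z/N\mathbb Z)^\times$ and $k=(k_1,k_2)$. Let $f\in M_k(\Gamma_{\simeq,\epsilon}(N))$ have Fourier expansion $f=\sum_{m_1,m_2\ge 0}c_{m_1,m_2}(f)q_1^{m_1}q_2^{m_2}$, $q_i=e^{2\pi i z_i/N}$, and suppose $c_{m_1,m_2}(f)=0$ unless $d\mid m_1$. Then $f\in M_k(\Gamma_{\simeq,\epsilon}(N/d))$, where $\epsilon$ is reduced modulo $N/d$.
   Context: $\mathfrak H$ is the upper half plane, $\mathfrak H^*=\mathfrak H\cup\mathbb P^1(\mathbb Q)$, $\Gamma(1)=\mathrm{SL}_2(\mathbb Z)$, $\Gamma_w(M)=\{\gamma\in\Gamma(1):\gamma\equiv I\bmod M\}$. For $M\ge1$ and $\epsilon\in(\mathbb Z/M\mathbb Z)^\times$, $\Gamma_{\simeq,\epsilon}(M)$ is the group of pairs $\left(\begin{pmatrix}a_1&b_1\\c_1&d_1\end{pmatrix},\begin{pmatrix}a_2&b_2\\c_2&d_2\end{pmatrix}\right)\in\Gamma(1)\times\Gamma(1)$ with $a_1\equiv a_2$, $b_1\equiv\epsilon b_2$, $\epsilon c_1\equiv c_2$, $d_1\equiv d_2\pmod M$. For $k=(k_1,k_2)$ natural numbers, $\gamma=(\gamma_1,\gamma_2)\in\mathrm{GL}_2^+(\mathbb R)^2$ and $f:\mathfrak H\times\mathfrak H\to\mathbb C$, $(f|_{k,\gamma})(z_1,z_2)=f(\gamma_1z_1,\gamma_2z_2)j(\gamma_1,z_1)^{-k_1}j(\gamma_2,z_2)^{-k_2}$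 where $j(\sigma,z)=(\det\sigma)^{-1/2}(cz+d)$ for $\sigma=\begin{pmatrix}a&b\\c&d\end{pmatrix}$. For a subgroup $\Gamma\subseteq\Gamma(1)\times\Gamma(1)$ containing some $\Gamma_w(M)\times\Gamma_w(M)$, $M_k(\Gamma)$ is the space of holomorphic $f$ on $\mathfrak H\times\mathfrak H$ with $f|_{k,\gamma}=f$ for all $\gamma\in\Gamma$ that are holomorphic at all cusps (for every $\gamma\in\Gamma(1)\times\Gamma(1)$, the Fourier expansions of $f|_{k,\gamma}$ in each variable have no negative-index terms). *)

theory Defs
  imports "HOL-Analysis.Analysis" "HOL-Number_Theory.Cong"
begin

definition upper_half_plane :: "complex set" where
  "upper_half_plane = {z. Im z > 0}"

definition SL2Z :: "(int^2^2) set" where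
  "SL2Z = {A. det A = 1}"

definition Gamma_w :: "nat \<Rightarrow> (int^2^2) set" where
  "Gamma_w M = {A \<in> SL2Z. \<forall>i j. [A $ i $ j = (mat 1 :: int^2^2) $ i $ j] (mod int M)}"

text \<open>The unit \<open>\<epsilon>\<close> modulo \<open>M\<close> is given by an integer representative; the group depends only
  on its residue class, so reduction to a divisor of \<open>M\<close> keeps the same integer.\<close>

definition Gamma_iso :: "int \<Rightarrow> nat \<Rightarrow> ((int^2^2) \<times> (int^2^2)) set" where
  "Gamma_iso \<epsilon> M = {(A, B). A \<in> SL2Z \<and> B \<in> SL2Z \<and>
      [A $ 1 $ 1 = B $ 1 $ 1] (mod int M) \<and>
      [A $ 1 $ 2 = \<epsilon> * B $ 1 $ 2] (mod int M) \<and>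
      [\<epsilon> * A $ 2 $ 1 = B $ 2 $ 1] (mod int M) \<and>
      [A $ 2 $ 2 = B $ 2 $ 2] (mod int M)}"

lemma Gamma_w_times_subset_Gamma_iso: "Gamma_w M \<times> Gamma_w M \<subseteq> Gamma_iso \<epsilon> M"
proof clarify
  fix A B assume A: "A \<in> Gamma_w M" and B: "B \<in> Gamma_w M"
  have *: "[A $ i $ j = B $ i $ j] (mod int M)" for i j
    using A B unfolding Gamma_w_def by (blast intro: cong_trans cong_sym)
  have off: "[C $ 1 $ 2 = 0] (mod int M)" "[C $ 2 $ 1 = 0] (mod int M)"
    if "C \<in> Gamma_w M" for C
  proof -
    have C: "[C $ i $ j = (if i = j then 1 else 0)] (mod int M)" for i j
      using that by (simp add: Gamma_w_def mat_def)
    show "[C $ 1 $ 2 = 0] (mod int M)" using C[of 1 2] by simp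
    show "[C $ 2 $ 1 = 0] (mod int M)" using C[of 2 1] by simp
  qed
  have "[A $ 1 $ 2 = \<epsilon> * B $ 1 $ 2] (mod int M)" "[\<epsilon> * A $ 2 $ 1 = B $ 2 $ 1] (mod int M)"
    using off[OF A] off[OF B] by (simp_all add: cong_0_iff cong_iff_dvd_diff dvd_diff)
  with * A B show "(A, B) \<in> Gamma_iso \<epsilon> M"
    by (auto simp: Gamma_iso_def Gamma_w_def)
qed

definition moebius :: "real^2^2 \<Rightarrow> complex \<Rightarrow> complex" where
  "moebius \<sigma> z = (of_real (\<sigma> $ 1 $ 1) * z + of_real (\<sigma> $ 1 $ 2)) /
                 (of_real (\<sigma> $ 2 $ 1) * z + of_real (\<sigma> $ 2 $ 2))"

definition aut_factor :: "real^2^2 \<Rightarrow> complex \<Rightarrow> complex" where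
  "aut_factor \<sigma> z = of_real (det \<sigma> powr (- 1 / 2)) *
                    (of_real (\<sigma> $ 2 $ 1) * z + of_real (\<sigma> $ 2 $ 2))"

text \<open>Only meaningful when both matrices have positive determinant.\<close>

definition slash :: "(complex \<times> complex \<Rightarrow> complex) \<Rightarrow> nat \<times> nat \<Rightarrow>
    (real^2^2) \<times> (real^2^2) \<Rightarrow> complex \<times> complex \<Rightarrow> complex" where
  "slash f k \<gamma> = (\<lambda>(z1, z2). f (moebius (fst \<gamma>) z1, moebius (snd \<gamma>) z2) *
      aut_factor (fst \<gamma>) z1 powi (- int (fst k)) * aut_factor (snd \<gamma>) z2 powi (- int (snd k)))"

definition real_pair :: "(int^2^2) \<times> (int^2^2) \<Rightarrow> (real^2^2) \<times> (real^2^2)" where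
  "real_pair = map_prod (map_matrix real_of_int) (map_matrix real_of_int)"

text \<open>Holomorphy in two variables is total differentiability with a complex-linear derivative.\<close>

definition holomorphic2_on :: "(complex \<times> complex \<Rightarrow> complex) \<Rightarrow> (complex \<times> complex) set \<Rightarrow> bool" where
  "holomorphic2_on f S \<longleftrightarrow>
     (\<forall>z\<in>S. \<exists>a b. (f has_derivative (\<lambda>(h1, h2). a * h1 + b * h2)) (at z within S))"

definition q_param :: "nat \<Rightarrow> complex \<Rightarrow> complex" where
  "q_param M z = exp (2 * of_real pi * \<i> * z / of_nat M)"

definition has_fourier_expansion :: "nat \<Rightarrow> (complex \<Rightarrow> complex) \<Rightarrow> (int \<Rightarrow> complex) \<Rightarrow> bool" where
  "has_fourier_expansion M g a \<longleftrightarrow>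
     (\<forall>z\<in>upper_half_plane. ((\<lambda>n. a n * q_param M z powi n) has_sum g z) UNIV)"

definition fourier_nonneg :: "nat \<Rightarrow> (complex \<Rightarrow> complex) \<Rightarrow> bool" where
  "fourier_nonneg M g \<longleftrightarrow> (\<exists>a. has_fourier_expansion M g a \<and> (\<forall>n<0. a n = 0))"

definition has_fourier_expansion2 ::
    "nat \<Rightarrow> (complex \<times> complex \<Rightarrow> complex) \<Rightarrow> (nat \<Rightarrow> nat \<Rightarrow> complex) \<Rightarrow> bool" where
  "has_fourier_expansion2 M f c \<longleftrightarrow>
     (\<forall>z1\<in>upper_half_plane. \<forall>z2\<in>upper_half_plane.
        ((\<lambda>(m1, m2). c m1 m2 * q_param M z1 ^ m1 * q_param M z2 ^ m2) has_sum f (z1, z2)) UNIV)"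

text \<open>Modular forms are functions on the product of two upper half planes, so values outside are
  irrelevant.  The number \<open>M\<close> is a level of \<open>\<Gamma>\<close>: the principal congruence subgroup of level \<open>M\<close>
  is normal, so every \<open>slash f k (real_pair \<gamma>)\<close> has period \<open>M\<close> in each variable.  Whether negative
  indices occur does not depend on the choice of \<open>M\<close>, since Fourier expansions are unique.\<close>

definition modular_forms :: "nat \<times> nat \<Rightarrow> ((int^2^2) \<times> (int^2^2)) set \<Rightarrow>
    (complex \<times> complex \<Rightarrow> complex) set" where
  "modular_forms k \<Gamma> = {f.
     holomorphic2_on f (upper_half_plane \<times> upper_half_plane) \<and>
     (\<forall>\<gamma>\<in>\<Gamma>. \<forall>z\<in>upper_half_plane \<times> upper_half_plane. slash f k (real_pair \<gamma>) z = f z) \<and>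
     (\<exists>M\<ge>1. Gamma_w M \<times> Gamma_w M \<subseteq> \<Gamma> \<and>
        (\<forall>\<gamma>\<in>SL2Z \<times> SL2Z.
           (\<forall>z2\<in>upper_half_plane. fourier_nonneg M (\<lambda>z1. slash f k (real_pair \<gamma>) (z1, z2))) \<and>
           (\<forall>z1\<in>upper_half_plane. fourier_nonneg M (\<lambda>z2. slash f k (real_pair \<gamma>) (z1, z2)))))}"

end

theory Submission
  imports Defs
begin

text \<open>Put \<open>M = N / d\<close>. The vanishing of the coefficients says exactly that \<open>f\<close> is invariant under
  \<open>(T^M, 1)\<close>, where \<open>T\<close> is the unit translation. Since each projection of \<open>\<Gamma>\<^sub>\<simeq>(N)\<close> to \<open>SL\<^sub>2(\<int>)\<close> is
  onto, the matrices \<open>A\<close> such that \<open>(A, 1)\<close> fixes \<open>f\<close> form a normal subgroup of \<open>SL\<^sub>2(\<int>)\<close>; it contains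
  \<open>\<Gamma>\<^sub>w(N)\<close> and \<open>T^M\<close>, and hence \<open>\<Gamma>\<^sub>w(M)\<close>, because over the semilocal ring \<open>\<int>/N\<close> the kernel of
  reduction modulo \<open>M\<close> is normally generated by \<open>T^M\<close>. Finally, every element of \<open>\<Gamma>\<^sub>\<simeq>(M)\<close> is the
  product of an element of \<open>\<Gamma>\<^sub>w(M) \<times> 1\<close> and an element of \<open>\<Gamma>\<^sub>\<simeq>(N)\<close>.\<close>

section \<open>Two-by-two matrices\<close>

definition mat2 :: "'a \<Rightarrow> 'a \<Rightarrow> 'a \<Rightarrow> 'a \<Rightarrow> 'a::zero^2^2" where
  "mat2 a b c d = vector [vector [a, b], vector [c, d]]"

lemma mat2_nth [simp]:
  "mat2 a b c d $ 1 $ 1 = a" "mat2 a b c d $ 1 $ 2 = b"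
  "mat2 a b c d $ 2 $ 1 = c" "mat2 a b c d $ 2 $ 2 = d"
  by (simp_all add: mat2_def)

lemma mat2_eq_iff:
  "A = B \<longleftrightarrow> A $ 1 $ 1 = B $ 1 $ 1 \<and> A $ 1 $ 2 = B $ 1 $ 2 \<and> A $ 2 $ 1 = B $ 2 $ 1 \<and> A $ 2 $ 2 = B $ 2 $ 2"
  for A B :: "'a^2^2"
  by (auto simp: vec_eq_iff forall_2)

lemma matrix_mult_nth_2:
  "(A ** B) $ i $ j = A $ i $ 1 * B $ 1 $ j + A $ i $ 2 * B $ 2 $ j"
  for A B :: "'a::semiring_1^2^2"
  by (simp add: matrix_matrix_mult_def sum_2)

lemma mat_1_nth_2 [simp]:
  "(mat 1 :: 'a::zero_neq_one^2^2) $ 1 $ 1 = 1" "(mat 1 :: 'a^2^2) $ 1 $ 2 = 0"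
  "(mat 1 :: 'a^2^2) $ 2 $ 1 = 0" "(mat 1 :: 'a^2^2) $ 2 $ 2 = 1"
  by (simp_all add: mat_def)

text \<open>The adjugate plays the role of the inverse on \<open>SL2Z\<close>. Its entries are
  linear in those of \<open>A\<close>, so everything stays over the integers.\<close>

definition adj2 :: "int^2^2 \<Rightarrow> int^2^2" where
  "adj2 A = mat2 (A $ 2 $ 2) (- A $ 1 $ 2) (- A $ 2 $ 1) (A $ 1 $ 1)"

lemma SL2Z_iff: "A \<in> SL2Z \<longleftrightarrow> A $ 1 $ 1 * A $ 2 $ 2 - A $ 1 $ 2 * A $ 2 $ 1 = 1"
  by (simp add: SL2Z_def det_2)

lemma mult_in_SL2Z: "A \<in> SL2Z \<Longrightarrow> B \<in> SL2Z \<Longrightarrow> A ** B \<in> SL2Z"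
  by (simp add: SL2Z_def det_mul)

lemma adj2_in_SL2Z: "A \<in> SL2Z \<Longrightarrow> adj2 A \<in> SL2Z"
  by (simp add: SL2Z_iff adj2_def algebra_simps)

lemma mat_1_in_SL2Z: "mat 1 \<in> SL2Z"
  by (simp add: SL2Z_iff)

lemma adj2_mult: "A \<in> SL2Z \<Longrightarrow> adj2 A ** A = mat 1"
  by (simp add: SL2Z_iff adj2_def mat2_eq_iff matrix_mult_nth_2 algebra_simps)

lemma mult_adj2: "A \<in> SL2Z \<Longrightarrow> A ** adj2 A = mat 1"
  by (simp add: SL2Z_iff adj2_def mat2_eq_iff matrix_mult_nth_2 algebra_simps)

lemma Gamma_w_iff:
  "A \<in> Gamma_w M \<longleftrightarrow> A \<in> SL2Z \<and> [A $ 1 $ 1 = 1] (mod int M) \<and> [A $ 1 $ 2 = 0] (mod int M) \<and>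
     [A $ 2 $ 1 = 0] (mod int M) \<and> [A $ 2 $ 2 = 1] (mod int M)"
  by (auto simp: Gamma_w_def forall_2)

text \<open>Modulo \<open>N\<close> the product has the same entries as \<open>adj2 A ** A\<close>,
  which is 1. Thus congruent matrices differ by a factor in \<open>Gamma_w N\<close>.\<close>

lemma adj2_mult_in_Gamma_w:
  assumes "A \<in> SL2Z" "B \<in> SL2Z" "\<And>i j. [A $ i $ j = B $ i $ j] (mod int N)"
  shows "adj2 A ** B \<in> Gamma_w N"
proof -
  have "[(adj2 A ** B) $ i $ j = (adj2 A ** A) $ i $ j] (mod int N)" for i j
    unfolding matrix_mult_nth_2 using assms(3)
    by (intro cong_add cong_mult cong_refl) (auto intro: cong_sym)
  thus ?thesis
    using assms by (simp add: Gamma_w_def mult_in_SL2Z adj2_in_SL2Z adj2_mult)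
qed

lemma mult_adj2_in_Gamma_w:
  assumes "A \<in> SL2Z" "B \<in> SL2Z" "\<And>i j. [A $ i $ j = B $ i $ j] (mod int N)"
  shows "A ** adj2 B \<in> Gamma_w N"
proof -
  have "[(A ** adj2 B) $ i $ j = (B ** adj2 B) $ i $ j] (mod int N)" for i j
    unfolding matrix_mult_nth_2 using assms(3)
    by (intro cong_add cong_mult cong_refl)
  thus ?thesis
    using assms by (simp add: Gamma_w_def mult_in_SL2Z adj2_in_SL2Z mult_adj2)
qed

section \<open>Lifting and normal generation of congruence subgroups\<close>

text \<open>Let \<open>k\<close> be the product of the primes that divide \<open>n\<close> but not
  \<open>a\<close>. A prime divisor of \<open>n\<close> that divides \<open>a\<close> divides
  neither \<open>b\<close> nor \<open>k\<close>; one that does not divide \<open>a\<close> divides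
  \<open>k\<close>. Either way it does not divide \<open>a + k * b\<close>.\<close>

lemma ex_add_mult_coprime:
  fixes a b n :: int
  assumes "coprime (gcd a b) n" and "n \<noteq> 0"
  shows "\<exists>k. coprime (a + k * b) n"
proof -
  define P where "P = {p \<in> prime_factors n. \<not> p dvd a}"
  define k where "k = \<Prod>P"
  have fin: "finite P" by (simp add: P_def)
  have "coprime (a + k * b) n"
  proof (rule ccontr)
    assume "\<not> coprime (a + k * b) n"
    then obtain p where p: "prime p" "p dvd a + k * b" "p dvd n"
      using prime_divisor_exists[of "gcd (a + k * b) n"] assms(2)
      by (auto simp: coprime_iff_gcd_eq_1)
    show False
    proof (cases "p dvd a")
      case True
      hence "p dvd k * b" using p(2) by (simp add: dvd_add_right_iff)
      moreover have "\<not> p dvd b"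
        using assms(1) p True by (meson coprime_common_divisor gcd_greatest not_prime_unit)
      ultimately have "p dvd k" using p(1) by (simp add: prime_dvd_mult_iff)
      then obtain q where q: "q \<in> P" "p dvd q"
        using prime_dvd_prod_iff[OF fin p(1)] by (auto simp: k_def)
      hence "p = q" using p(1) by (auto simp: P_def intro: primes_dvd_imp_eq)
      thus False using q True by (simp add: P_def)
    next
      case False
      hence "p \<in> P" using p assms(2) by (simp add: P_def in_prime_factors_iff)
      hence "p dvd k" unfolding k_def using dvd_prodI[OF fin, of p "\<lambda>q. q"] by simp
      hence "p dvd a" using p(2) by (simp add: dvd_add_left_iff)
      with False show False by simp
    qed
  qed
  thus ?thesis ..
qed

text \<open>Surjectivity of reduction modulo \<open>N\<close> on SL2: the lower row is first moved
  within its residue classes to a coprime pair, then a Bezout relation corrects the upper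
  row.\<close>

lemma SL2Z_lift:
  fixes a b c d :: int
  assumes "N \<ge> 1" and "[a * d - b * c = 1] (mod int N)"
  obtains A where "A \<in> SL2Z" "[A $ 1 $ 1 = a] (mod int N)" "[A $ 1 $ 2 = b] (mod int N)"
    "[A $ 2 $ 1 = c] (mod int N)" "[A $ 2 $ 2 = d] (mod int N)"
proof -
  define n where "n = int N"
  \<comment> \<open>A zero entry is traded for \<open>n\<close>, because
    \<open>ex_add_mult_coprime\<close> needs a nonzero modulus.\<close>
  define c' where "c' = (if c = 0 then n else c)"
  have c': "c' \<noteq> 0" "[c' = c] (mod n)"
    using assms(1) by (auto simp: c'_def n_def cong_0_iff)
  have det: "[a * d - b * c' = 1] (mod n)"
    using assms(2) c'(2) unfolding n_def[symmetric]
    by (metis cong_diff cong_mult cong_refl cong_trans)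
  \<comment> \<open>A common divisor of \<open>d\<close>, \<open>n\<close> and \<open>c'\<close>
    divides the determinant, which is 1 modulo \<open>n\<close>.\<close>
  have "coprime (gcd d n) c'"
  proof (rule coprimeI)
    fix e assume e: "e dvd gcd d n" "e dvd c'"
    hence "e dvd a * d - b * c'" by auto
    moreover have "e dvd n" using e by simp
    ultimately show "e dvd 1"
      using det by (metis cong_dvd_iff cong_dvd_modulus)
  qed
  then obtain k where k: "coprime (d + k * n) c'"
    using ex_add_mult_coprime c'(1) by blast
  define d' where "d' = d + k * n"
  have d': "[d' = d] (mod n)" by (simp add: d'_def cong_iff_dvd_diff)
  have "[a * d' - b * c' = 1] (mod n)"
    using det d' by (metis cong_diff cong_mult cong_refl cong_trans)
  then obtain s where s: "a * d' - b * c' = 1 + n * s"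
    by (metis cong_iff_lin cong_sym)
  obtain x y where xy: "x * d' + y * c' = 1"
    using k bezout_int[of d' c'] by (auto simp: d'_def coprime_iff_gcd_eq_1)
  show ?thesis
  \<comment> \<open>The determinant is off by \<open>n * s\<close>; shifting the upper row by
    \<open>n * s\<close> times \<open>(-x, y)\<close> changes it by
    \<open>- n * s * (x * d' + y * c')\<close>, which is exactly \<open>- n * s\<close>.\<close>
  proof (rule that[of "mat2 (a - n * s * x) (b + n * s * y) c' d'"])
    have "(a - n * s * x) * d' - (b + n * s * y) * c'
        = (a * d' - b * c') - n * s * (x * d' + y * c')"
      by (simp add: algebra_simps)
    thus "mat2 (a - n * s * x) (b + n * s * y) c' d' \<in> SL2Z"
      by (simp add: SL2Z_iff s xy)
  qed (use c' d' in \<open>auto simp: cong_iff_dvd_diff n_def\<close>)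
qed

text \<open>If the upper left entry is a unit modulo \<open>N\<close>, the matrix is matched modulo
  \<open>N\<close> by a product of conjugates of powers of \<open>T^M\<close>, and the quotient lies
  in \<open>Gamma_w N\<close>. The general case reduces to this one by a left translation.\<close>

lemma Gamma_w_subset_normal_subgroup:
  fixes K :: "(int^2^2) set" and M N :: nat
  assumes N: "N \<ge> 1"
    and mult: "\<And>A B. A \<in> K \<Longrightarrow> B \<in> K \<Longrightarrow> A ** B \<in> K"
    and conj: "\<And>A B. A \<in> K \<Longrightarrow> B \<in> SL2Z \<Longrightarrow> B ** A ** adj2 B \<in> K"
    and transl: "\<And>x. mat2 1 (int M * x) 0 1 \<in> K"
    and principal: "Gamma_w N \<subseteq> K"
  shows "Gamma_w M \<subseteq> K"
proof
  define m where "m = int M"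
  have lower: "mat2 1 0 (m * x) 1 \<in> K" for x
  proof -
    \<comment> \<open>Conjugation by the inversion matrix swaps upper and lower unipotents and flips
      the sign.\<close>
    have "mat2 0 (-1) 1 0 ** mat2 1 (int M * - x) 0 1 ** adj2 (mat2 0 (-1) 1 0) \<in> K"
      by (rule conj[OF transl]) (simp add: SL2Z_iff)
    also have "mat2 0 (-1) 1 0 ** mat2 1 (int M * - x) 0 1 ** adj2 (mat2 0 (-1) 1 0)
        = mat2 1 0 (m * x) 1"
      by (simp add: mat2_eq_iff matrix_mult_nth_2 adj2_def m_def)
    finally show ?thesis .
  qed
  \<comment> \<open>A conjugate of a power of \<open>T^M\<close> with prescribed upper left entry \<open>1 + m * t\<close>.\<close>
  have corner: "mat2 (1 + m * t) (m * t) (- m * t) (1 - m * t) \<in> K" for t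
  proof -
    have "mat2 1 0 (-1) 1 ** mat2 1 (int M * t) 0 1 ** adj2 (mat2 1 0 (-1) 1) \<in> K"
      by (rule conj[OF transl]) (simp add: SL2Z_iff)
    also have "mat2 1 0 (-1) 1 ** mat2 1 (int M * t) 0 1 ** adj2 (mat2 1 0 (-1) 1)
        = mat2 (1 + m * t) (m * t) (- m * t) (1 - m * t)"
      by (simp add: mat2_eq_iff matrix_mult_nth_2 adj2_def m_def)
    finally show ?thesis .
  qed
  have unit_corner: "A \<in> K" if A: "A \<in> Gamma_w M" and cop: "coprime (A $ 1 $ 1) (int N)" for A
  proof -
    have SL: "A \<in> SL2Z" using A by (simp add: Gamma_w_def)
    obtain t where t: "A $ 1 $ 1 = 1 + m * t"
      using A unfolding Gamma_w_iff m_def by (metis cong_iff_lin cong_sym)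
    obtain b where b: "A $ 1 $ 2 = m * b"
      using A unfolding Gamma_w_iff m_def by (auto simp: cong_0_iff)
    obtain c where c: "A $ 2 $ 1 = m * c"
      using A unfolding Gamma_w_iff m_def by (auto simp: cong_0_iff)
    define a where "a = A $ 1 $ 1"
    obtain u where u: "[a * u = 1] (mod int N)"
      using cop cong_solve_coprime_int unfolding a_def by blast
    then obtain v where v: "a * u = 1 + int N * v"
      by (metis cong_iff_lin cong_sym)
    define E where "E = mat2 (1 + m * t) (m * t) (- m * t) (1 - m * t)"
    \<comment> \<open>The middle factor \<open>E\<close> has the required corner \<open>a\<close>.
      The outer factors leave it alone and add \<open>a * u * m * (b - t)\<close> and
      \<open>a * u * m * (c + t)\<close> to the off-diagonal entries \<open>m * t\<close> and
      \<open>- m * t\<close>; since \<open>u\<close> inverts \<open>a\<close> modulo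
      \<open>N\<close>, the results are congruent to \<open>m * b\<close> and
      \<open>m * c\<close>.\<close>
    define P where "P = mat2 1 0 (m * (u * (c + t))) 1 ** E ** mat2 1 (m * (u * (b - t))) 0 1"
    have PK: "P \<in> K"
      unfolding P_def E_def using mult[OF mult[OF lower corner] transl] by (simp add: m_def)
    have PSL: "P \<in> SL2Z"
      unfolding P_def E_def by (intro mult_in_SL2Z) (simp_all add: SL2Z_iff algebra_simps)
    have P11: "P $ 1 $ 1 = a"
      by (simp add: P_def E_def matrix_mult_nth_2 a_def t)
    have "P $ 1 $ 2 = m * t + (a * u) * (m * (b - t))"
      by (simp add: P_def E_def matrix_mult_nth_2 a_def t algebra_simps)
    hence "P $ 1 $ 2 - A $ 1 $ 2 = int N * (v * m * (b - t))"
      unfolding v b by (simp add: algebra_simps)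
    hence P12: "[P $ 1 $ 2 = A $ 1 $ 2] (mod int N)"
      by (simp add: cong_iff_dvd_diff)
    have "P $ 2 $ 1 = (a * u) * (m * (c + t)) - m * t"
      by (simp add: P_def E_def matrix_mult_nth_2 a_def t algebra_simps)
    hence "P $ 2 $ 1 - A $ 2 $ 1 = int N * (v * m * (c + t))"
      unfolding v c by (simp add: algebra_simps)
    hence P21: "[P $ 2 $ 1 = A $ 2 $ 1] (mod int N)"
      by (simp add: cong_iff_dvd_diff)
    \<comment> \<open>The last entry is forced by the determinant, as \<open>a\<close> can be
      cancelled modulo \<open>N\<close>.\<close>
    have "a * P $ 2 $ 2 = 1 + P $ 1 $ 2 * P $ 2 $ 1" "a * A $ 2 $ 2 = 1 + A $ 1 $ 2 * A $ 2 $ 1"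
      using PSL SL P11 unfolding SL2Z_iff a_def by simp_all
    hence "[a * P $ 2 $ 2 = a * A $ 2 $ 2] (mod int N)"
      using P12 P21 by (auto intro!: cong_add cong_mult)
    hence P22: "[P $ 2 $ 2 = A $ 2 $ 2] (mod int N)"
      using cop by (simp add: a_def cong_mult_lcancel)
    have "adj2 P ** A \<in> Gamma_w N"
    proof (rule adj2_mult_in_Gamma_w[OF PSL SL])
      show "[P $ i $ j = A $ i $ j] (mod int N)" for i j
        using P11 P12 P21 P22 exhaust_2[of i] exhaust_2[of j] by (auto simp: a_def)
    qed
    hence "P ** (adj2 P ** A) \<in> K" using PK mult principal by blast
    thus "A \<in> K" by (simp add: matrix_mul_assoc mult_adj2 PSL)
  qed
  fix A assume A: "A \<in> Gamma_w M"
  hence SL: "A $ 1 $ 1 * A $ 2 $ 2 - A $ 1 $ 2 * A $ 2 $ 1 = 1"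
    by (simp add: Gamma_w_def SL2Z_iff)
  \<comment> \<open>The corner is coprime to the entry below it by the determinant, and to
    \<open>m\<close> because it is 1 modulo \<open>m\<close>. Hence adding a multiple
    \<open>m * r\<close> of the lower row to the upper one can make it a unit modulo
    \<open>N\<close>.\<close>
  have "coprime (A $ 1 $ 1) (A $ 2 $ 1)"
  proof (rule coprimeI)
    fix e assume "e dvd A $ 1 $ 1" "e dvd A $ 2 $ 1"
    hence "e dvd A $ 1 $ 1 * A $ 2 $ 2 - A $ 1 $ 2 * A $ 2 $ 1" by simp
    thus "e dvd 1" by (simp only: SL)
  qed
  moreover have "coprime (A $ 1 $ 1) m"
    using A unfolding Gamma_w_iff m_def by (metis cong_imp_coprime coprime_1_left cong_sym)
  ultimately have "coprime (A $ 1 $ 1) (m * A $ 2 $ 1)" by simp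
  then obtain r where r: "coprime (A $ 1 $ 1 + r * (m * A $ 2 $ 1)) (int N)"
    using ex_add_mult_coprime[of "A $ 1 $ 1" "m * A $ 2 $ 1" "int N"] N by auto
  define B where "B = mat2 1 (m * r) 0 1 ** A"
  have "B \<in> Gamma_w M"
  proof -
    have "m dvd m * r * z" for z by simp
    thus ?thesis
      using A unfolding Gamma_w_iff B_def
      by (auto simp: mult_in_SL2Z SL2Z_iff[of "mat2 _ _ _ _"] matrix_mult_nth_2 m_def
          cong_iff_dvd_diff diff_add_eq[symmetric] mult.assoc)
  qed
  moreover have "coprime (B $ 1 $ 1) (int N)"
    using r by (simp add: B_def matrix_mult_nth_2 ac_simps)
  ultimately have "B \<in> K" by (rule unit_corner)
  hence "mat2 1 (int M * - r) 0 1 ** B \<in> K" by (rule mult[OF transl])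
  also have "mat2 1 (int M * - r) 0 1 ** B = A"
    by (simp add: mat2_eq_iff B_def matrix_mult_nth_2 m_def)
  finally show "A \<in> K" .
qed

section \<open>Surjectivity of the two projections of \<open>Gamma_iso\<close>\<close>

lemma Gamma_iso_fst_surj:
  assumes "N \<ge> 1" "coprime \<epsilon> (int N)" "A \<in> SL2Z"
  obtains B where "(A, B) \<in> Gamma_iso \<epsilon> N"
proof -
  obtain u where u: "[\<epsilon> * u = 1] (mod int N)"
    using assms(2) cong_solve_coprime_int by blast
  \<comment> \<open>The partner of \<open>A\<close> must have off-diagonal entries
    \<open>u * A $ 1 $ 2\<close> and \<open>\<epsilon> * A $ 2 $ 1\<close> modulo \<open>N\<close>;
    as \<open>\<epsilon> * u\<close> is 1 there, the determinant is still 1 and the residues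
    lift.\<close>
  have "[A $ 1 $ 1 * A $ 2 $ 2 - (\<epsilon> * u) * (A $ 1 $ 2 * A $ 2 $ 1)
      = A $ 1 $ 1 * A $ 2 $ 2 - 1 * (A $ 1 $ 2 * A $ 2 $ 1)] (mod int N)"
    by (intro cong_diff cong_mult cong_refl u)
  hence "[A $ 1 $ 1 * A $ 2 $ 2 - (u * A $ 1 $ 2) * (\<epsilon> * A $ 2 $ 1) = 1] (mod int N)"
    using assms(3) by (simp add: SL2Z_iff ac_simps)
  then obtain B where B: "B \<in> SL2Z" "[B $ 1 $ 1 = A $ 1 $ 1] (mod int N)"
    "[B $ 1 $ 2 = u * A $ 1 $ 2] (mod int N)" "[B $ 2 $ 1 = \<epsilon> * A $ 2 $ 1] (mod int N)"
    "[B $ 2 $ 2 = A $ 2 $ 2] (mod int N)"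
    using SL2Z_lift[OF assms(1)] by blast
  have "[\<epsilon> * B $ 1 $ 2 = \<epsilon> * (u * A $ 1 $ 2)] (mod int N)"
    by (intro cong_mult cong_refl B)
  moreover have "[(\<epsilon> * u) * A $ 1 $ 2 = 1 * A $ 1 $ 2] (mod int N)"
    by (intro cong_mult cong_refl u)
  ultimately have "[\<epsilon> * B $ 1 $ 2 = A $ 1 $ 2] (mod int N)"
    unfolding mult.assoc mult_1 by (rule cong_trans)
  hence "(A, B) \<in> Gamma_iso \<epsilon> N"
    using B assms(3) by (auto simp: Gamma_iso_def intro: cong_sym)
  thus ?thesis by (rule that)
qed

lemma Gamma_iso_snd_surj:
  assumes "N \<ge> 1" "coprime \<epsilon> (int N)" "B \<in> SL2Z"
  obtains A where "(A, B) \<in> Gamma_iso \<epsilon> N"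
proof -
  obtain u where u: "[\<epsilon> * u = 1] (mod int N)"
    using assms(2) cong_solve_coprime_int by blast
  have "[B $ 1 $ 1 * B $ 2 $ 2 - (\<epsilon> * u) * (B $ 1 $ 2 * B $ 2 $ 1)
      = B $ 1 $ 1 * B $ 2 $ 2 - 1 * (B $ 1 $ 2 * B $ 2 $ 1)] (mod int N)"
    by (intro cong_diff cong_mult cong_refl u)
  hence "[B $ 1 $ 1 * B $ 2 $ 2 - (\<epsilon> * B $ 1 $ 2) * (u * B $ 2 $ 1) = 1] (mod int N)"
    using assms(3) by (simp add: SL2Z_iff ac_simps)
  then obtain A where A: "A \<in> SL2Z" "[A $ 1 $ 1 = B $ 1 $ 1] (mod int N)"
    "[A $ 1 $ 2 = \<epsilon> * B $ 1 $ 2] (mod int N)" "[A $ 2 $ 1 = u * B $ 2 $ 1] (mod int N)"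
    "[A $ 2 $ 2 = B $ 2 $ 2] (mod int N)"
    using SL2Z_lift[OF assms(1)] by blast
  have "[\<epsilon> * A $ 2 $ 1 = \<epsilon> * (u * B $ 2 $ 1)] (mod int N)"
    by (intro cong_mult cong_refl A)
  moreover have "[(\<epsilon> * u) * B $ 2 $ 1 = 1 * B $ 2 $ 1] (mod int N)"
    by (intro cong_mult cong_refl u)
  ultimately have "[\<epsilon> * A $ 2 $ 1 = B $ 2 $ 1] (mod int N)"
    unfolding mult.assoc mult_1 by (rule cong_trans)
  hence "(A, B) \<in> Gamma_iso \<epsilon> N"
    using A assms(3) by (auto simp: Gamma_iso_def)
  thus ?thesis by (rule that)
qed

lemma Gamma_iso_antimono:
  assumes "M dvd N"
  shows "Gamma_iso \<epsilon> N \<subseteq> Gamma_iso \<epsilon> M"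
  using assms by (auto simp: Gamma_iso_def intro: cong_dvd_modulus)

section \<open>The stabilizer of a function\<close>

lemma denominator_nonzero:
  assumes "A \<in> SL2Z" "z \<in> upper_half_plane"
  shows "of_int (A $ 2 $ 1) * z + of_int (A $ 2 $ 2) \<noteq> (0::complex)"
proof
  assume eq: "of_int (A $ 2 $ 1) * z + of_int (A $ 2 $ 2) = (0::complex)"
  from arg_cong[OF eq, of Im] assms(2) have c: "A $ 2 $ 1 = 0"
    by (simp add: upper_half_plane_def)
  with eq have "A $ 2 $ 2 = 0" by simp
  with c assms(1) show False by (simp add: SL2Z_iff)
qed

lemma moebius_map_matrix:
  "moebius (map_matrix real_of_int A) z =
     (of_int (A $ 1 $ 1) * z + of_int (A $ 1 $ 2)) / (of_int (A $ 2 $ 1) * z + of_int (A $ 2 $ 2))"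
  by (simp add: moebius_def map_matrix_def)

lemma aut_factor_map_matrix:
  assumes "A \<in> SL2Z"
  shows "aut_factor (map_matrix real_of_int A) z = of_int (A $ 2 $ 1) * z + of_int (A $ 2 $ 2)"
proof -
  have "det (map_matrix real_of_int A) = real_of_int (A $ 1 $ 1 * A $ 2 $ 2 - A $ 1 $ 2 * A $ 2 $ 1)"
    by (simp add: det_2 map_matrix_def)
  also have "\<dots> = 1" using assms unfolding SL2Z_iff by simp
  finally show ?thesis by (simp add: aut_factor_def map_matrix_def)
qed

lemma moebius_in_upper_half_plane:
  assumes "A \<in> SL2Z" "z \<in> upper_half_plane"
  shows "moebius (map_matrix real_of_int A) z \<in> upper_half_plane"
proof -
  define w where "w = of_int (A $ 2 $ 1) * z + of_int (A $ 2 $ 2)"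
  have w: "w \<noteq> 0" using denominator_nonzero[OF assms] by (simp add: w_def)
  have det: "real_of_int (A $ 1 $ 1) * A $ 2 $ 2 - A $ 1 $ 2 * A $ 2 $ 1 = 1"
    using assms(1) unfolding SL2Z_iff by (metis of_int_1 of_int_diff of_int_mult)
  have "Im (moebius (map_matrix real_of_int A) z)
      = (real_of_int (A $ 1 $ 1) * A $ 2 $ 2 - A $ 1 $ 2 * A $ 2 $ 1) * Im z / (norm w)\<^sup>2"
    unfolding moebius_map_matrix w_def[symmetric] Im_divide cmod_power2[symmetric]
    by (simp add: w_def algebra_simps)
  also have "\<dots> > 0"
    using w assms(2) unfolding det by (simp add: upper_half_plane_def)
  finally show ?thesis by (simp add: upper_half_plane_def)
qed

text \<open>The cocycle relation, which makes \<open>slash\<close> a right action.\<close>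

lemma aut_factor_mult:
  assumes "A \<in> SL2Z" "B \<in> SL2Z" "z \<in> upper_half_plane"
  shows "aut_factor (map_matrix real_of_int (A ** B)) z =
     aut_factor (map_matrix real_of_int A) (moebius (map_matrix real_of_int B) z) *
     aut_factor (map_matrix real_of_int B) z"
  using denominator_nonzero[OF assms(2,3)] assms
  by (simp add: aut_factor_map_matrix mult_in_SL2Z moebius_map_matrix matrix_mult_nth_2 field_simps)

lemma moebius_mult:
  assumes "A \<in> SL2Z" "B \<in> SL2Z" "z \<in> upper_half_plane"
  shows "moebius (map_matrix real_of_int (A ** B)) z =
     moebius (map_matrix real_of_int A) (moebius (map_matrix real_of_int B) z)"
proof -
  define p q r s where "p = complex_of_int (A $ 1 $ 1)" "q = complex_of_int (A $ 1 $ 2)"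
    "r = complex_of_int (A $ 2 $ 1)" "s = complex_of_int (A $ 2 $ 2)"
  define x where "x = of_int (B $ 1 $ 1) * z + of_int (B $ 1 $ 2)"
  define y where "y = of_int (B $ 2 $ 1) * z + of_int (B $ 2 $ 2)"
  have y: "y \<noteq> 0" using denominator_nonzero[OF assms(2,3)] by (simp add: y_def)
  have "moebius (map_matrix real_of_int (A ** B)) z = (p * x + q * y) / (r * x + s * y)"
    by (simp add: moebius_map_matrix matrix_mult_nth_2 x_def y_def p_q_r_s_def algebra_simps)
  also have "\<dots> = ((p * (x / y) + q) * y) / ((r * (x / y) + s) * y)"
    using y by (simp add: distrib_right)
  finally show ?thesis
    using y by (simp add: moebius_map_matrix x_def y_def p_q_r_s_def)
qed

lemma moebius_mat_1 [simp]: "moebius (map_matrix real_of_int (mat 1)) z = z"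
  by (simp add: moebius_map_matrix)

lemma aut_factor_mat_1 [simp]: "aut_factor (map_matrix real_of_int (mat 1)) z = 1"
  by (simp add: aut_factor_map_matrix mat_1_in_SL2Z)

section \<open>The slash action and the group fixing a function\<close>

definition slash_stabilizer ::
    "(complex \<times> complex \<Rightarrow> complex) \<Rightarrow> nat \<times> nat \<Rightarrow> ((int^2^2) \<times> (int^2^2)) set" where
  "slash_stabilizer f k = {\<gamma> \<in> SL2Z \<times> SL2Z.
     \<forall>z\<in>upper_half_plane \<times> upper_half_plane. slash f k (real_pair \<gamma>) z = f z}"

lemma slash_real_pair:
  "slash f k (real_pair (A, B)) (z, w) =
     f (moebius (map_matrix real_of_int A) z, moebius (map_matrix real_of_int B) w) *
     aut_factor (map_matrix real_of_int A) z powi (- int (fst k)) *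
     aut_factor (map_matrix real_of_int B) w powi (- int (snd k))"
  by (simp add: slash_def real_pair_def)

lemma slash_mult:
  assumes "A \<in> SL2Z" "B \<in> SL2Z" "A' \<in> SL2Z" "B' \<in> SL2Z"
    and "z \<in> upper_half_plane" "w \<in> upper_half_plane"
  shows "slash f k (real_pair (A ** A', B ** B')) (z, w) =
    slash (slash f k (real_pair (A, B))) k (real_pair (A', B')) (z, w)"
  using assms
  by (simp add: slash_real_pair moebius_mult aut_factor_mult power_int_mult_distrib ac_simps)

text \<open>Invariance is known only on the product of half planes. This suffices for replacing a
  function under \<open>slash\<close>, because Moebius maps preserve the half plane.\<close>

lemma slash_cong:
  assumes "\<And>z. z \<in> upper_half_plane \<times> upper_half_plane \<Longrightarrow> f z = g z"
    and "A \<in> SL2Z" "B \<in> SL2Z" "z \<in> upper_half_plane" "w \<in> upper_half_plane"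
  shows "slash f k (real_pair (A, B)) (z, w) = slash g k (real_pair (A, B)) (z, w)"
  using assms by (simp add: slash_real_pair moebius_in_upper_half_plane)

lemma slash_stabilizer_mult:
  assumes "(A, B) \<in> slash_stabilizer f k" "(A', B') \<in> slash_stabilizer f k"
  shows "(A ** A', B ** B') \<in> slash_stabilizer f k"
proof -
  have SL: "A \<in> SL2Z" "B \<in> SL2Z" "A' \<in> SL2Z" "B' \<in> SL2Z"
    using assms by (simp_all add: slash_stabilizer_def)
  have "slash f k (real_pair (A ** A', B ** B')) (z, w) = f (z, w)"
    if zw: "z \<in> upper_half_plane" "w \<in> upper_half_plane" for z w
  proof -
    have "slash f k (real_pair (A ** A', B ** B')) (z, w)
        = slash (slash f k (real_pair (A, B))) k (real_pair (A', B')) (z, w)"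
      by (rule slash_mult[OF SL zw])
    also have "\<dots> = slash f k (real_pair (A', B')) (z, w)"
      by (rule slash_cong[OF _ SL(3,4) zw]) (use assms(1) in \<open>auto simp: slash_stabilizer_def\<close>)
    also have "\<dots> = f (z, w)" using assms(2) zw by (simp add: slash_stabilizer_def)
    finally show ?thesis .
  qed
  thus ?thesis using SL by (auto simp: slash_stabilizer_def mult_in_SL2Z)
qed

text \<open>Write \<open>f\<close> as its own slash by \<open>(A, B)\<close> and apply the inverse
  pair: the two actions cancel.\<close>

lemma slash_stabilizer_adj2:
  assumes "(A, B) \<in> slash_stabilizer f k"
  shows "(adj2 A, adj2 B) \<in> slash_stabilizer f k"
proof -
  have SL: "A \<in> SL2Z" "B \<in> SL2Z"
    using assms by (simp_all add: slash_stabilizer_def)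
  note SL' = adj2_in_SL2Z[OF SL(1)] adj2_in_SL2Z[OF SL(2)]
  have "slash f k (real_pair (adj2 A, adj2 B)) (z, w) = f (z, w)"
    if zw: "z \<in> upper_half_plane" "w \<in> upper_half_plane" for z w
  proof -
    have "slash f k (real_pair (adj2 A, adj2 B)) (z, w)
        = slash (slash f k (real_pair (A, B))) k (real_pair (adj2 A, adj2 B)) (z, w)"
      by (rule slash_cong[OF _ SL' zw]) (use assms in \<open>auto simp: slash_stabilizer_def\<close>)
    also have "\<dots> = slash f k (real_pair (A ** adj2 A, B ** adj2 B)) (z, w)"
      by (rule slash_mult[OF SL SL' zw, symmetric])
    also have "\<dots> = f (z, w)" by (simp add: mult_adj2 SL slash_real_pair)
    finally show ?thesis .
  qed
  thus ?thesis using SL' by (auto simp: slash_stabilizer_def)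
qed

lemma Gamma_iso_subset_slash_stabilizer:
  assumes "N \<ge> 1" "M dvd N" "coprime \<epsilon> (int N)"
    and iso: "Gamma_iso \<epsilon> N \<subseteq> slash_stabilizer f k"
    and transl: "\<And>x. (mat2 1 (int M * x) 0 1, mat 1) \<in> slash_stabilizer f k"
  shows "Gamma_iso \<epsilon> M \<subseteq> slash_stabilizer f k"
proof -
  define K where "K = {A. (A, mat 1) \<in> slash_stabilizer f k}"
  have "Gamma_w M \<subseteq> K"
  proof (rule Gamma_w_subset_normal_subgroup[OF assms(1)])
    show "A ** B \<in> K" if "A \<in> K" "B \<in> K" for A B
      using slash_stabilizer_mult[of A "mat 1" f k B "mat 1"] that by (simp add: K_def)
    show "B ** A ** adj2 B \<in> K" if A: "A \<in> K" and B: "B \<in> SL2Z" for A B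
    proof -
      \<comment> \<open>Any \<open>B\<close> extends to a pair fixing \<open>f\<close>. Conjugating
        \<open>(A, mat 1)\<close> by that pair leaves the second component trivial, so
        \<open>K\<close> is normal.\<close>
      obtain C where "(B, C) \<in> Gamma_iso \<epsilon> N"
        using Gamma_iso_fst_surj[OF assms(1,3) B] .
      hence BC: "(B, C) \<in> slash_stabilizer f k" using iso by blast
      hence C: "C \<in> SL2Z" by (simp add: slash_stabilizer_def)
      have "(B ** A ** adj2 B, C ** mat 1 ** adj2 C) \<in> slash_stabilizer f k"
        using A BC unfolding K_def
        by (intro slash_stabilizer_mult slash_stabilizer_adj2) auto
      thus ?thesis by (simp add: K_def mult_adj2[OF C])
    qed
    show "mat2 1 (int M * x) 0 1 \<in> K" for x by (simp add: K_def transl)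
    have "mat 1 \<in> Gamma_w N" by (simp add: Gamma_w_def mat_1_in_SL2Z)
    thus "Gamma_w N \<subseteq> K"
      using iso Gamma_w_times_subset_Gamma_iso[of N \<epsilon>] unfolding K_def by blast
  qed
  show ?thesis
  proof clarify
    fix A B assume AB: "(A, B) \<in> Gamma_iso \<epsilon> M"
    hence SL: "A \<in> SL2Z" "B \<in> SL2Z" by (simp_all add: Gamma_iso_def)
    \<comment> \<open>Both \<open>A\<close> and \<open>C\<close> are partners of \<open>B\<close>
      modulo \<open>M\<close>, hence congruent there, and \<open>(A, B)\<close> factors as
      \<open>(A ** adj2 C, mat 1)\<close> times \<open>(C, B)\<close>.\<close>
    obtain C where C: "(C, B) \<in> Gamma_iso \<epsilon> N"
      using Gamma_iso_snd_surj[OF assms(1,3) SL(2)] .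
    hence CM: "(C, B) \<in> Gamma_iso \<epsilon> M" using Gamma_iso_antimono[OF assms(2)] by blast
    have CSL: "C \<in> SL2Z" using C by (simp add: Gamma_iso_def)
    have "coprime \<epsilon> (int M)"
      using assms(2,3) by (meson coprime_divisors dvd_refl int_dvd_int_iff)
    \<comment> \<open>The lower left entries are compared only after multiplication by
      \<open>\<epsilon>\<close>, a unit modulo \<open>M\<close>.\<close>
    moreover have "[\<epsilon> * A $ 2 $ 1 = \<epsilon> * C $ 2 $ 1] (mod int M)"
      using AB CM unfolding Gamma_iso_def by (auto intro: cong_trans cong_sym)
    ultimately have A21: "[A $ 2 $ 1 = C $ 2 $ 1] (mod int M)"
      by (simp add: cong_mult_lcancel)
    have "[A $ i $ j = C $ i $ j] (mod int M)" for i j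
      using AB CM A21 exhaust_2[of i] exhaust_2[of j] unfolding Gamma_iso_def
      by (auto intro: cong_trans cong_sym)
    hence "A ** adj2 C \<in> Gamma_w M"
      by (rule mult_adj2_in_Gamma_w[OF SL(1) CSL])
    hence "(A ** adj2 C, mat 1) \<in> slash_stabilizer f k"
      using \<open>Gamma_w M \<subseteq> K\<close> unfolding K_def by blast
    moreover have "(C, B) \<in> slash_stabilizer f k" using C iso by blast
    ultimately have "(A ** adj2 C ** C, mat 1 ** B) \<in> slash_stabilizer f k"
      by (rule slash_stabilizer_mult)
    thus "(A, B) \<in> slash_stabilizer f k"
      by (simp add: matrix_mul_assoc[symmetric] adj2_mult CSL)
  qed
qed

section \<open>From vanishing coefficients to translation invariance\<close>

lemma fourier_expansion2_periodic:
  assumes exp: "has_fourier_expansion2 N f c" and vanish: "\<And>m1 m2. \<not> d dvd m1 \<Longrightarrow> c m1 m2 = 0"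
    and N: "N = d * M" "N \<ge> 1" and z: "z \<in> upper_half_plane" "w \<in> upper_half_plane"
  shows "f (z + of_int (int M * x), w) = f (z, w)"
proof -
  have z': "z + of_int (int M * x) \<in> upper_half_plane"
    using z(1) by (simp add: upper_half_plane_def)
  \<comment> \<open>As \<open>N = d * M\<close>, the translation multiplies
    \<open>q_param N z\<close> by a \<open>d\<close>-th root of unity, which disappears in powers
    divisible by \<open>d\<close>. All other terms vanish, so the two series agree term by
    term.\<close>
  have q: "q_param N (z + of_int (int M * x)) ^ m = q_param N z ^ m" if dm: "d dvd m" for m
  proof -
    obtain l where l: "m = d * l" using dm by blast
    have M: "complex_of_nat N \<noteq> 0" using N by simp
    have "of_nat m * (2 * of_real pi * \<i> * (z + of_int (int M * x)) / of_nat N)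
        = of_nat m * (2 * of_real pi * \<i> * z / of_nat N)
          + 2 * of_real pi * \<i> * of_int (int l * x)"
      using M by (simp add: l N field_simps)
    also have "exp \<dots> = exp (of_nat m * (2 * of_real pi * \<i> * z / of_nat N))"
      by (simp add: exp_add exp_eq_1 mult.commute) (metis of_int_mult of_int_of_nat_eq)
    finally show ?thesis by (simp add: q_param_def exp_of_nat_mult[symmetric])
  qed
  have eq: "(\<lambda>(m1, m2). c m1 m2 * q_param N (z + of_int (int M * x)) ^ m1 * q_param N w ^ m2)
      = (\<lambda>(m1, m2). c m1 m2 * q_param N z ^ m1 * q_param N w ^ m2)"
    using q vanish by (auto simp: fun_eq_iff)
  have "((\<lambda>(m1, m2). c m1 m2 * q_param N (z + of_int (int M * x)) ^ m1 * q_param N w ^ m2)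
      has_sum f (z + of_int (int M * x), w)) UNIV"
    using exp z' z(2) unfolding has_fourier_expansion2_def by blast
  moreover have "((\<lambda>(m1, m2). c m1 m2 * q_param N z ^ m1 * q_param N w ^ m2) has_sum f (z, w)) UNIV"
    using exp z unfolding has_fourier_expansion2_def by blast
  ultimately show ?thesis unfolding eq by (rule has_sum_unique)
qed

theorem theorem2p5:
  fixes N d :: nat and \<epsilon> :: int and k :: "nat \<times> nat"
    and f :: "complex \<times> complex \<Rightarrow> complex" and c :: "nat \<Rightarrow> nat \<Rightarrow> complex"
  assumes "N \<ge> 1" and "d \<ge> 1" and "d dvd N" and "coprime \<epsilon> (int N)"
    and "f \<in> modular_forms k (Gamma_iso \<epsilon> N)"
    and "has_fourier_expansion2 N f c"
    and "\<And>m1 m2. \<not> d dvd m1 \<Longrightarrow> c m1 m2 = 0"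
  shows "f \<in> modular_forms k (Gamma_iso \<epsilon> (N div d))"
proof -
  define M where "M = N div d"
  have N: "N = d * M" using assms(3) by (simp add: M_def)
  hence MN: "M dvd N" by simp
  have "Gamma_iso \<epsilon> N \<subseteq> SL2Z \<times> SL2Z" by (auto simp: Gamma_iso_def)
  hence iso: "Gamma_iso \<epsilon> N \<subseteq> slash_stabilizer f k"
    using assms(5) by (auto simp: modular_forms_def slash_stabilizer_def)
  \<comment> \<open>A translation matrix has automorphy factor 1, so its slash is a plain shift of
    the first variable.\<close>
  have transl: "(mat2 1 (int M * x) 0 1, mat 1) \<in> slash_stabilizer f k" for x
  proof -
    have SL: "mat2 1 (int M * x) 0 1 \<in> SL2Z" by (simp add: SL2Z_iff)
    have "slash f k (real_pair (mat2 1 (int M * x) 0 1, mat 1)) (z, w) = f (z, w)"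
      if "z \<in> upper_half_plane" "w \<in> upper_half_plane" for z w
      using fourier_expansion2_periodic[OF assms(6,7) N assms(1) that, of x]
      by (simp add: slash_real_pair moebius_map_matrix aut_factor_map_matrix[OF SL])
    thus ?thesis using SL by (auto simp: slash_stabilizer_def mat_1_in_SL2Z)
  qed
  have "Gamma_iso \<epsilon> M \<subseteq> slash_stabilizer f k"
    by (rule Gamma_iso_subset_slash_stabilizer[OF assms(1) MN assms(4) iso transl])
  hence "\<forall>\<gamma>\<in>Gamma_iso \<epsilon> M. \<forall>z\<in>upper_half_plane \<times> upper_half_plane. slash f k (real_pair \<gamma>) z = f z"
    unfolding slash_stabilizer_def by blast
  \<comment> \<open>Holomorphy carries over. The cusp condition ranges over all of
    \<open>SL2Z \<times> SL2Z\<close>, and a level of \<open>Gamma_iso \<epsilon> N\<close> is also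
    one of the larger group \<open>Gamma_iso \<epsilon> M\<close>.\<close>
  thus ?thesis
    using assms(5) Gamma_iso_antimono[OF MN, of \<epsilon>] unfolding M_def[symmetric] modular_forms_def
    by (auto dest: subset_trans)
qed

end
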